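(* Let $\beta>0$ and let $S$ be a real symmetric $n\times n$ matrix with zero diagonal. For $\alpha>0$ let $$U(x)=\sum_{i=1}^{n}\frac14 x_i^4+\frac{\beta-\alpha^2}{2}x^Tx-\frac12 x^TSx,\qquad x\in\mathbb{R}^n,$$ and let $\alpha_0>0$ be a constant such that for every $\alpha>\alpha_0$ the set of signum vectors of the local minimum points of $U$ is $\{-1,1\}^n$. Then there exists $\alpha_*\ge\alpha_0$ such that for every $\alpha>\alpha_*$: if $x_0$ is a global minimum point of $U$, then $\operatorname{sgn}(x_0)$ is a minimizer of the Ising problem $\min_{v\in\{-1,1\}^n}E(v)$, where $E(v)=-\frac12 v^TSv$.
   Context: For $x=(x_1,\dots,x_n)\in\mathbb{R}^n$, $\operatorname{sgn}(x)=(\operatorname{sgn}(x_1),\dots,\operatorname{sgn}(x_n))\in\{-1,0,1\}^n$ is the signum vector. The function $U$ depends on the parameter $\alpha>0$; $\beta$ and $S=(s_{ij})$ (symmetric, $s_{ii}=0$ for all $i$) are fixed. The thresholds $\alpha_0,\alpha_*$ may depend on $\beta$ and $S$. *)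

theory Defs
  imports "HOL-Analysis.Analysis"
begin

definition U :: "real \<Rightarrow> real ^ 'n ^ 'n \<Rightarrow> real \<Rightarrow> real ^ 'n \<Rightarrow> real" where
  "U \<beta> S \<alpha> x =
     (\<Sum>i\<in>UNIV. 1/4 * (x $ i) ^ 4) + (\<beta> - \<alpha>\<^sup>2) / 2 * (x \<bullet> x) - 1/2 * (x \<bullet> (S *v x))"

definition ising_energy :: "real ^ 'n ^ 'n \<Rightarrow> real ^ 'n \<Rightarrow> real" where
  "ising_energy S v = - (1/2) * (v \<bullet> (S *v v))"

definition spin_vectors :: "(real ^ 'n) set" where
  "spin_vectors = {v. \<forall>i. v $ i \<in> {-1, 1}}"

(* The library's sgn on real ^ 'n is normalisation, x / norm x; this is the componentwise sign. *)
definition signum_vector :: "real ^ 'n \<Rightarrow> real ^ 'n" where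
  "signum_vector x = (\<chi> i. sgn (x $ i))"

definition local_min_point :: "('a::topological_space \<Rightarrow> real) \<Rightarrow> 'a \<Rightarrow> bool" where
  "local_min_point f x \<longleftrightarrow> (\<forall>\<^sub>F y in nhds x. f x \<le> f y)"

definition global_min_point :: "('a \<Rightarrow> real) \<Rightarrow> 'a \<Rightarrow> bool" where
  "global_min_point f x \<longleftrightarrow> (\<forall>y. f x \<le> f y)"

end

theory Submission
  imports Defs
begin

text \<open>
  Put \<open>m = \<alpha>\<^sup>2 - \<beta>\<close> and substitute \<open>x = sqrt m *\<^sub>R z\<close>. Completing the square turns \<open>U\<close> into
  \<open>m\<^sup>2/4 (\<Sum>i. (z\<^sub>i\<^sup>2 - 1)\<^sup>2) + m E(z)\<close> up to a constant. Comparing a global minimum point with the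
  points \<open>sqrt m *\<^sub>R v\<close>, where the quartic term vanishes, gives
  \<open>m/4 (\<Sum>i. (z\<^sub>i\<^sup>2 - 1)\<^sup>2) \<le> E(v) - E(z)\<close>. The left side is at least \<open>m/4\<close> times the squared distance
  from \<open>z\<close> to its signum vector \<open>\<sigma>\<close>, while \<open>E(z)\<close> differs from \<open>E(\<sigma>)\<close> by at most a linear plus a
  quadratic term in that distance. Hence \<open>E(\<sigma>) - E(v)\<close> is at most of order \<open>1/m\<close>, which for large
  \<open>m\<close> is smaller than the least positive difference of two Ising energies.
\<close>

lemma signum_vector_scaleR:
  assumes "c > 0"
  shows "signum_vector (c *\<^sub>R x) = signum_vector x"
  using assms by (simp add: signum_vector_def vec_eq_iff sgn_mult)

lemma finite_spin_vectors: "finite (spin_vectors :: (real ^ 'n) set)"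
proof -
  have "spin_vectors \<subseteq> (\<lambda>f. \<chi> i. f i) ` {f :: 'n \<Rightarrow> real. range f \<subseteq> {-1, 1}}"
  proof
    fix v :: "real ^ 'n" assume "v \<in> spin_vectors"
    then have "($) v \<in> {f. range f \<subseteq> {-1, 1}}" by (auto simp: spin_vectors_def)
    then show "v \<in> (\<lambda>f. \<chi> i. f i) ` {f :: 'n \<Rightarrow> real. range f \<subseteq> {-1, 1}}"
      by (rule rev_image_eqI) simp
  qed
  moreover have "finite {f :: 'n \<Rightarrow> real. range f \<subseteq> {-1, 1}}"
    using finite_set_of_finite_funs[of "UNIV :: 'n set" "{-1, 1 :: real}" undefined]
    by (simp add: image_subset_iff)
  ultimately show ?thesis by (meson finite_imageI finite_subset)
qed

lemma spin_vector_square: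
  assumes "v \<in> spin_vectors"
  shows "(v $ i)\<^sup>2 = 1"
proof -
  have "v $ i = -1 \<or> v $ i = 1" using assms by (simp add: spin_vectors_def)
  then show ?thesis by auto
qed

lemma norm_spin_vector:
  fixes v :: "real ^ 'n"
  assumes "v \<in> spin_vectors"
  shows "norm v = sqrt (CARD('n))"
  using assms by (simp add: norm_eq_sqrt_inner inner_vec_def spin_vector_square
      flip: power2_eq_square)

lemma finite_positive_gap:
  fixes f :: "'a \<Rightarrow> real"
  assumes "finite A"
  obtains g where "g > 0" "\<And>v w. v \<in> A \<Longrightarrow> w \<in> A \<Longrightarrow> f v < f w \<Longrightarrow> g \<le> f w - f v"
proof
  \<comment> \<open>The element 1 keeps \<open>D\<close> nonempty, so that \<open>Min D\<close>
    makes sense even when \<open>f\<close> is constant on \<open>A\<close>.\<close>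
  define D where "D = insert 1 {d \<in> (\<lambda>(v, w). f w - f v) ` (A \<times> A). d > 0}"
  have D: "finite D" "D \<noteq> {}" "\<forall>d\<in>D. d > 0"
    using assms by (auto simp: D_def)
  then show "Min D > 0" by simp
  fix v w assume "v \<in> A" "w \<in> A" "f v < f w"
  then have "f w - f v \<in> D" by (auto simp: D_def)
  with D show "Min D \<le> f w - f v" by simp
qed

lemma ising_energy_scaleR: "ising_energy S (c *\<^sub>R v) = c\<^sup>2 * ising_energy S v"
  by (simp add: ising_energy_def matrix_vector_mult_scaleR power2_eq_square)

text \<open>Symmetry of \<open>S\<close> makes the two cross terms equal, so their halves add up to
  one full term.\<close>

lemma ising_energy_add:
  fixes S :: "real ^ 'n ^ 'n"
  assumes "transpose S = S"
  shows "ising_energy S (v + d) = ising_energy S v - v \<bullet> (S *v d) + ising_energy S d"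
proof -
  have "d \<bullet> (S *v v) = v \<bullet> (S *v d)"
    using assms by (metis dot_lmul_matrix inner_commute transpose_matrix_vector)
  then show ?thesis
    by (simp add: ising_energy_def matrix_vector_right_distrib inner_add_left inner_add_right
        algebra_simps)
qed

lemma U_scaled:
  fixes z :: "real ^ 'n" and m :: real
  assumes "\<alpha>\<^sup>2 - \<beta> = m" "m \<ge> 0"
  shows "U \<beta> S \<alpha> (sqrt m *\<^sub>R z)
    = m\<^sup>2 / 4 * (\<Sum>i\<in>UNIV. ((z $ i)\<^sup>2 - 1)\<^sup>2) + m * ising_energy S z - CARD('n) * m\<^sup>2 / 4"
proof -
  have s2: "(sqrt m)\<^sup>2 = m" using assms by simp
  have s4: "sqrt m ^ 4 = m\<^sup>2"
    using power_mult[of "sqrt m" 2 2] s2 by simp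
  have "U \<beta> S \<alpha> (sqrt m *\<^sub>R z)
    = (\<Sum>i\<in>UNIV. 1/4 * (sqrt m * z $ i) ^ 4) - m / 2 * (m * (z \<bullet> z)) + m * ising_energy S z"
  proof -
    have "(\<beta> - \<alpha>\<^sup>2) / 2 = - (m / 2)" using assms by simp
    moreover have "(sqrt m *\<^sub>R z) \<bullet> (sqrt m *\<^sub>R z) = m * (z \<bullet> z)"
      using assms by (simp flip: mult.assoc)
    moreover have "- (1/2) * ((sqrt m *\<^sub>R z) \<bullet> (S *v (sqrt m *\<^sub>R z))) = m * ising_energy S z"
      using ising_energy_scaleR[of S "sqrt m" z] unfolding ising_energy_def s2 .
    ultimately show ?thesis
      unfolding U_def by simp
  qed
  also have "(\<Sum>i\<in>UNIV. 1/4 * (sqrt m * z $ i) ^ 4) = m\<^sup>2 / 4 * (\<Sum>i\<in>UNIV. (z $ i) ^ 4)"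
    by (simp add: power_mult_distrib s4 sum_distrib_left)
  \<comment> \<open>Completing the square in each coordinate: the resulting
    \<open>2 * (z \<bullet> z)\<close>, weighted by \<open>m\<^sup>2 / 4\<close>, cancels the
    quadratic term of \<open>U\<close>.\<close>
  also have "(\<Sum>i\<in>UNIV. (z $ i) ^ 4)
    = (\<Sum>i\<in>UNIV. ((z $ i)\<^sup>2 - 1)\<^sup>2) + 2 * (z \<bullet> z) - CARD('n)"
    by (simp add: inner_vec_def power2_diff sum.distrib sum_subtractf sum_distrib_left
        flip: power2_eq_square)
  finally show ?thesis by (simp add: power2_eq_square algebra_simps)
qed

text \<open>Coordinatewise, for a nonzero, the distance from a to its sign is that of |a| to 1, and
  a^2 - 1 = (|a| - 1)(|a| + 1) with second factor at least 1. For a = 0 the left side is 0.\<close>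

lemma norm_diff_signum_vector_le:
  "(norm (z - signum_vector z))\<^sup>2 \<le> (\<Sum>i\<in>UNIV. ((z $ i)\<^sup>2 - 1)\<^sup>2)"
proof -
  have "(a - sgn a)\<^sup>2 \<le> (a\<^sup>2 - 1)\<^sup>2" for a :: real
  proof (cases "a = 0")
    case False
    have "(a - sgn a)\<^sup>2 = (\<bar>a\<bar> - 1)\<^sup>2 * 1"
      using False by (auto simp: sgn_if abs_if power2_eq_square algebra_simps)
    also have "\<dots> \<le> (\<bar>a\<bar> - 1)\<^sup>2 * (\<bar>a\<bar> + 1)\<^sup>2"
      by (intro mult_left_mono) (auto simp: one_le_power)
    also have "\<dots> = (\<bar>a\<bar>\<^sup>2 - 1)\<^sup>2"
      by (simp only: power_mult_distrib[symmetric]) (simp add: power2_eq_square algebra_simps)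
    finally show ?thesis by simp
  qed simp
  then show ?thesis
    by (simp add: power2_norm_eq_inner inner_vec_def signum_vector_def sum_mono
        flip: power2_eq_square)
qed

text \<open>A quadratic with negative discriminant and positive constant term is positive
  everywhere.\<close>

lemma quadratic_pos:
  fixes c g l t :: real
  assumes "g > 0" "l\<^sup>2 < 4 * g * c"
  shows "c * t\<^sup>2 - l * t + g > 0"
proof -
  \<comment> \<open>Multiplying by \<open>4 * g\<close> instead of \<open>4 * c\<close> uses the
    known sign of \<open>g\<close>. The first summand is positive unless t = 0, where the square
    equals 4 g^2.\<close>
  have "4 * g * (c * t\<^sup>2 - l * t + g) = (4 * g * c - l\<^sup>2) * t\<^sup>2 + (l * t - 2 * g)\<^sup>2"
    by (simp add: power2_eq_square algebra_simps)
  also have "\<dots> > 0"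
  proof (cases "t = 0")
    case False
    with assms show ?thesis by (simp add: add_pos_nonneg)
  qed (use assms in simp)
  finally show ?thesis using assms(1) by (simp add: zero_less_mult_iff)
qed

lemma global_min_point_imp_local_min_point: "global_min_point f x \<Longrightarrow> local_min_point f x"
  by (simp add: global_min_point_def local_min_point_def)

text \<open>With \<open>K\<close> bounding the operator norm of \<open>S\<close>, the energy excess
  is at most a concave quadratic in \<open>norm d\<close>; the second part of \<open>g\<close> is
  the discriminant condition keeping it below \<open>g\<close>.\<close>

lemma ising_energy_signum_global_min_point_less:
  fixes S :: "real ^ 'n ^ 'n" and m K :: real
  assumes sym: "transpose S = S"
    and K: "\<And>x. norm (S *v x) \<le> K * norm x"
    and m: "\<alpha>\<^sup>2 - \<beta> = m" "m > 0"
    and g: "g > 0" "CARD('n) * K\<^sup>2 < g * (m - 2 * K)"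
    and min: "global_min_point (U \<beta> S \<alpha>) x"
    and sig: "signum_vector x \<in> spin_vectors"
    and v: "v \<in> spin_vectors"
  shows "ising_energy S (signum_vector x) - ising_energy S v < g"
proof -
  define z where "z = (1 / sqrt m) *\<^sub>R x"
  define d where "d = z - signum_vector z"
  define l where "l = sqrt (CARD('n)) * K"
  have xz: "x = sqrt m *\<^sub>R z" and sz: "signum_vector x = signum_vector z"
    using m by (simp_all add: z_def signum_vector_scaleR)
  have "U \<beta> S \<alpha> (sqrt m *\<^sub>R z) \<le> U \<beta> S \<alpha> (sqrt m *\<^sub>R v)"
    using min xz by (simp add: global_min_point_def)
  \<comment> \<open>The quartic sum vanishes at \<open>v\<close>, and the constant of
    \<open>U_scaled\<close> cancels.\<close>
  then have "m * (m / 4 * (\<Sum>i\<in>UNIV. ((z $ i)\<^sup>2 - 1)\<^sup>2) + ising_energy S z) \<le> m * ising_energy S v"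
    using U_scaled[OF m(1), of S] m v
    by (simp add: spin_vector_square power2_eq_square[of m] algebra_simps)
  then have "m / 4 * (\<Sum>i\<in>UNIV. ((z $ i)\<^sup>2 - 1)\<^sup>2) + ising_energy S z \<le> ising_energy S v"
    using m by simp
  moreover have "m / 4 * (norm d)\<^sup>2 \<le> m / 4 * (\<Sum>i\<in>UNIV. ((z $ i)\<^sup>2 - 1)\<^sup>2)"
    using m norm_diff_signum_vector_le[of z] unfolding d_def by (intro mult_left_mono) auto
  moreover have "ising_energy S z
    = ising_energy S (signum_vector z) - signum_vector z \<bullet> (S *v d) + ising_energy S d"
    using ising_energy_add[OF sym, of "signum_vector z" d] by (simp add: d_def)
  moreover have "signum_vector z \<bullet> (S *v d) \<le> l * norm d"
  proof -
    have "signum_vector z \<bullet> (S *v d) \<le> norm (signum_vector z) * norm (S *v d)"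
      by (rule norm_cauchy_schwarz)
    also have "\<dots> \<le> norm (signum_vector z) * (K * norm d)"
      by (intro mult_left_mono K) simp
    finally show ?thesis using sig sz by (simp add: l_def norm_spin_vector)
  qed
  moreover have "- ising_energy S d \<le> K / 2 * (norm d)\<^sup>2"
  proof -
    have "d \<bullet> (S *v d) \<le> norm d * norm (S *v d)" by (rule norm_cauchy_schwarz)
    also have "\<dots> \<le> norm d * (K * norm d)" by (intro mult_left_mono K) simp
    finally show ?thesis by (simp add: ising_energy_def power2_eq_square algebra_simps)
  qed
  \<comment> \<open>Here \<open>4 * g * (m / 4 - K / 2)\<close> equals
    \<open>g * (m - 2 * K)\<close>, and the square of \<open>l\<close> is
    \<open>CARD('n) * K\<^sup>2\<close>.\<close>
  moreover have "(m / 4 - K / 2) * (norm d)\<^sup>2 - l * norm d + g > 0"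
    using g by (intro quadratic_pos) (simp_all add: l_def power_mult_distrib algebra_simps)
  ultimately show ?thesis by (simp add: sz left_diff_distrib)
qed

theorem theorem1p1:
  fixes S :: "real ^ 'n ^ 'n" and \<beta> \<alpha>\<^sub>0 :: real
  assumes "\<beta> > 0"
    and "transpose S = S"
    and "\<forall>i. S $ i $ i = 0"
    and "\<alpha>\<^sub>0 > 0"
    and "\<forall>\<alpha>>\<alpha>\<^sub>0. signum_vector ` {x. local_min_point (U \<beta> S \<alpha>) x} = spin_vectors"
  shows "\<exists>\<alpha>s\<ge>\<alpha>\<^sub>0. \<forall>\<alpha>>\<alpha>s. \<forall>x\<^sub>0. global_min_point (U \<beta> S \<alpha>) x\<^sub>0 \<longrightarrow>
           is_arg_min (ising_energy S) (\<lambda>v. v \<in> spin_vectors) (signum_vector x\<^sub>0)"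
proof -
  obtain g where g: "g > 0" and gap: "\<And>v w. v \<in> spin_vectors \<Longrightarrow> w \<in> spin_vectors \<Longrightarrow>
      ising_energy S v < ising_energy S w \<Longrightarrow> g \<le> ising_energy S w - ising_energy S v"
    using finite_positive_gap[OF finite_spin_vectors, of "ising_energy S"] by metis
  obtain K where K: "K > 0" "\<And>x. norm (S *v x) \<le> K * norm x"
    using linear_bounded_pos[OF matrix_vector_mul_linear[of S]] by metis
  \<comment> \<open>Solving the discriminant condition for m gives exactly m >
    \<open>M\<close>.\<close>
  define M where "M = 2 * K + CARD('n) * K\<^sup>2 / g"
  \<comment> \<open>The bound 1 ensures \<open>\<alpha> \<le> \<alpha>\<^sup>2\<close>, so \<alpha>
    > \<beta> + M already forces \<open>\<alpha>\<^sup>2 - \<beta> > M\<close> without a square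
    root.\<close>
  define \<alpha>s where "\<alpha>s = max \<alpha>\<^sub>0 (max 1 (\<beta> + M))"
  have "is_arg_min (ising_energy S) (\<lambda>v. v \<in> spin_vectors) (signum_vector x)"
    if \<alpha>: "\<alpha> > \<alpha>s" and min: "global_min_point (U \<beta> S \<alpha>) x" for \<alpha> x
  proof -
    have \<alpha>': "\<alpha> > \<alpha>\<^sub>0" "\<alpha> > 1" "\<alpha> > \<beta> + M" using \<alpha> by (auto simp: \<alpha>s_def)
    then have "\<alpha> \<le> \<alpha>\<^sup>2" by (simp add: self_le_power)
    with \<alpha>' have m: "\<alpha>\<^sup>2 - \<beta> > M" by simp
    have "M > 0" using K g by (simp add: M_def add_pos_nonneg)
    with m have mpos: "\<alpha>\<^sup>2 - \<beta> > 0" by simp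
    have "CARD('n) * K\<^sup>2 / g < \<alpha>\<^sup>2 - \<beta> - 2 * K" using m by (simp add: M_def)
    then have gm: "CARD('n) * K\<^sup>2 < g * (\<alpha>\<^sup>2 - \<beta> - 2 * K)"
      using g by (simp add: pos_divide_less_eq mult.commute)
    \<comment> \<open>A global minimum point is a local one, so the assumption on local minima rules
      out zero coordinates.\<close>
    have sig: "signum_vector x \<in> spin_vectors"
      using assms(5) \<alpha>'(1) global_min_point_imp_local_min_point[OF min] by blast
    \<comment> \<open>A spin vector of lower energy would be lower by at least \<open>g\<close>,
      against the excess being below \<open>g\<close>.\<close>
    have "\<not> ising_energy S v < ising_energy S (signum_vector x)" if v: "v \<in> spin_vectors" for v
      using ising_energy_signum_global_min_point_less
        [OF assms(2) K(2) refl mpos g gm min sig v] gap[OF v sig] by force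
    with sig show ?thesis by (auto simp: is_arg_min_def)
  qed
  moreover have "\<alpha>s \<ge> \<alpha>\<^sub>0" by (simp add: \<alpha>s_def)
  ultimately show ?thesis by blast
qed

end
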